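(* Let $\mathcal G$ be a family of smooth isotropic metrics $\tilde g=\tilde c^{-2}dx^2$ on $M$ satisfying $$\overline\Omega\subset\Phi_{\tilde g}(\Gamma\times[0,r_0)),\qquad\tilde g\in\mathcal G,$$ where $r_0>0$ is fixed. Let $c^{-2}dx^2\in\mathcal G$ and suppose that $$\|\tilde c-c\|_{C^2(M)}\le\epsilon\qquad\text{for all }\tilde c^{-2}dx^2\in\mathcal G.$$ Then, for small enough $\epsilon>0$, there is $C>0$ such that for all $\tilde c^{-2}dx^2\in\mathcal G$, $$\|\tilde c^2-c^2\|_{C(\Omega)}\le C\,\|H_{\tilde c}-H_c\|_{C^1(M)\to C^1(\Gamma\times[0,r_0))}.$$
   Context: $M\subset\mathbb R^n$ is a compact connected domain with smooth boundary, $\Gamma\subset\partial M$ is open, $\Omega\subset M$. The functions $\tilde c$, $c$ are smooth and strictly positive on $M$. For a smooth Riemannian metric $g$ on $M$ with distance $d$ and inward unit normal $\nu$ to $\partial M$, and for $y\in\Gamma$, $\gamma(\cdot;y,\nu)$ is the unit speed geodesic starting at $y$ in direction $\nu$, $\tau_M(y,\nu)$ its exit time from $M$, $\sigma_\Gamma(y)=\max\{s\in(0,\tau_M(y,\nu)]:d(\gamma(s;y,\nu),\Gamma)=s\}$, and $\Phi_g(y,s)=\gamma(s;y,\nu)$ on $\mathrm{Domain}(\Phi_g)=\{(y,s):y\in\Gamma,\ 0\le s<\sigma_\Gamma(y)\}$; $\Phi_g$ is a diffeomorphism onto its image. It is understood that $\Gamma\times[0,r_0)\subset\mathrm{Domain}(\Phi_{\tilde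 g})$ for all $\tilde g\in\mathcal G$. For $g=c^{-2}dx^2$, the map $H_c:\{\phi\in C^\infty(M):\Delta\phi=0\}\to C^\infty(\mathrm{Domain}(\Phi_g))$ is $H_c\phi(y,s)=\phi(\Phi_g(y,s))$, with $\Delta$ the Euclidean Laplacian. The norm $\|H_{\tilde c}-H_c\|_{C^1(M)\to C^1(\Gamma\times[0,r_0))}$ is the operator norm on harmonic functions $\phi\in C^\infty(M)$ equipped with the $C^1(M)$ norm, i.e. the supremum of $\|H_{\tilde c}\phi-H_c\phi\|_{C^1(\Gamma\times[0,r_0))}$ over such $\phi$ with $\|\phi\|_{C^1(M)}\le1$. *)

theory Defs
  imports "HOL-Analysis.Analysis"
begin

section \<open>Smooth functions and \<open>C\<^sup>k\<close> norms\<close>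

text \<open>Derivatives are taken \<open>within\<close> the set \<open>S\<close>, which will be an open set or a closed domain with
  smooth boundary. In both cases they are unique, at boundary points too, and only the values on
  \<open>S\<close> matter. \<open>iter_deriv S f [v\<^sub>1, \<dots>, v\<^sub>k]\<close> is \<open>\<partial>\<close> in direction \<open>v\<^sub>1\<close> of \<dots> of \<open>\<partial>\<close> in direction
  \<open>v\<^sub>k\<close> of \<open>f\<close>.\<close>

fun iter_deriv :: "'a::euclidean_space set \<Rightarrow> ('a \<Rightarrow> real) \<Rightarrow> 'a list \<Rightarrow> 'a \<Rightarrow> real" where
  "iter_deriv S f [] = f"
| "iter_deriv S f (v # vs) = (\<lambda>x. frechet_derivative (iter_deriv S f vs) (at x within S) v)"

definition smooth_on_open :: "'a::euclidean_space set \<Rightarrow> ('a \<Rightarrow> real) \<Rightarrow> bool" where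
  "smooth_on_open U f \<longleftrightarrow>
     open U \<and> (\<forall>vs\<in>lists Basis. \<forall>x\<in>U. iter_deriv U f vs differentiable (at x))"

text \<open>\<open>C\<^sup>\<infinity>(M)\<close> for a closed domain \<open>M\<close>: smooth up to the boundary, i.e. with a smooth extension to a
  neighbourhood of \<open>M\<close>.\<close>

definition smooth_on_domain :: "'a::euclidean_space set \<Rightarrow> ('a \<Rightarrow> real) \<Rightarrow> bool" where
  "smooth_on_domain M f \<longleftrightarrow> (\<exists>U F. M \<subseteq> U \<and> smooth_on_open U F \<and> (\<forall>x\<in>M. F x = f x))"

text \<open>All norms take values in the extended nonnegative reals, so that suprema need no side
  conditions.\<close>

definition sup_norm_on :: "'b set \<Rightarrow> ('b \<Rightarrow> real) \<Rightarrow> ennreal" where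
  "sup_norm_on A f = (SUP x\<in>A. ennreal \<bar>f x\<bar>)"

definition Ck_norm :: "'a::euclidean_space set \<Rightarrow> nat \<Rightarrow> ('a \<Rightarrow> real) \<Rightarrow> ennreal" where
  "Ck_norm M k f = (SUP vs\<in>{vs \<in> lists Basis. length vs \<le> k}. sup_norm_on M (iter_deriv M f vs))"

definition laplacian :: "'a::euclidean_space set \<Rightarrow> ('a \<Rightarrow> real) \<Rightarrow> 'a \<Rightarrow> real" where
  "laplacian M f x = (\<Sum>b\<in>Basis. iter_deriv M f [b, b] x)"

definition harmonic_functions :: "'a::euclidean_space set \<Rightarrow> ('a \<Rightarrow> real) set" where
  "harmonic_functions M = {\<phi>. smooth_on_domain M \<phi> \<and> (\<forall>x\<in>M. laplacian M \<phi> x = 0)}"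

section \<open>Domains with smooth boundary\<close>

definition boundary_defining_function ::
    "'a::euclidean_space set \<Rightarrow> 'a \<Rightarrow> 'a set \<Rightarrow> ('a \<Rightarrow> real) \<Rightarrow> bool" where
  "boundary_defining_function M p U \<rho> \<longleftrightarrow>
     p \<in> U \<and> smooth_on_open U \<rho> \<and> (\<forall>x\<in>U. \<exists>w. frechet_derivative \<rho> (at x) w \<noteq> 0) \<and>
     M \<inter> U = {x \<in> U. \<rho> x \<le> 0}"

definition smooth_compact_domain :: "'a::euclidean_space set \<Rightarrow> bool" where
  "smooth_compact_domain M \<longleftrightarrow> compact M \<and> connected M \<and> M \<noteq> {} \<and>
     (\<forall>p\<in>frontier M. \<exists>U \<rho>. boundary_defining_function M p U \<rho>)"

text \<open>\<open>T\<^sub>p\<partial>M\<close>; the kernel does not depend on the defining function.\<close>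

definition boundary_tangent_space :: "'a::euclidean_space set \<Rightarrow> 'a \<Rightarrow> 'a set" where
  "boundary_tangent_space M p =
     {w. \<exists>U \<rho>. boundary_defining_function M p U \<rho> \<and> frechet_derivative \<rho> (at p) w = 0}"

section \<open>Riemannian metrics on \<open>M\<close>\<close>

text \<open>A metric is given by its coefficient matrix in Cartesian coordinates.\<close>

type_synonym 'n metric = "real^'n \<Rightarrow> real^'n^'n"

definition g_inner :: "'n::finite metric \<Rightarrow> real^'n \<Rightarrow> real^'n \<Rightarrow> real^'n \<Rightarrow> real" where
  "g_inner g x v w = v \<bullet> (g x *v w)"

definition g_norm :: "'n::finite metric \<Rightarrow> real^'n \<Rightarrow> real^'n \<Rightarrow> real" where
  "g_norm g x v = sqrt (g_inner g x v v)"

definition isotropic_metric :: "(real^'n \<Rightarrow> real) \<Rightarrow> 'n::finite metric" where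
  "isotropic_metric c x = (1 / (c x)\<^sup>2) *\<^sub>R mat 1"

definition inward_unit_normal ::
    "(real^'n) set \<Rightarrow> 'n::finite metric \<Rightarrow> real^'n \<Rightarrow> real^'n" where
  "inward_unit_normal M g p = (THE \<nu>. g_norm g p \<nu> = 1 \<and>
     (\<forall>w\<in>boundary_tangent_space M p. g_inner g p \<nu> w = 0) \<and>
     (\<exists>U \<rho>. boundary_defining_function M p U \<rho> \<and> frechet_derivative \<rho> (at p) \<nu> < 0))"

text \<open>The library's piecewise \<open>C\<^sup>1\<close> curves may have unbounded speed near a break point; the
  nonnegative Lebesgue integral then correctly gives length \<open>\<infinity>\<close> if the curve is not rectifiable.\<close>

definition g_length :: "'n::finite metric \<Rightarrow> (real \<Rightarrow> real^'n) \<Rightarrow> ennreal" where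
  "g_length g \<gamma> =
     (\<integral>\<^sup>+t\<in>{0..1}. ennreal (g_norm g (\<gamma> t) (vector_derivative \<gamma> (at t))) \<partial>lborel)"

definition g_dist :: "(real^'n) set \<Rightarrow> 'n::finite metric \<Rightarrow> real^'n \<Rightarrow> real^'n \<Rightarrow> ennreal" where
  "g_dist M g x z = (INF \<gamma>\<in>{\<gamma>. \<gamma> piecewise_C1_differentiable_on {0..1} \<and> path_image \<gamma> \<subseteq> M \<and>
     pathstart \<gamma> = x \<and> pathfinish \<gamma> = z}. g_length g \<gamma>)"

definition g_setdist ::
    "(real^'n) set \<Rightarrow> 'n::finite metric \<Rightarrow> real^'n \<Rightarrow> (real^'n) set \<Rightarrow> ennreal" where
  "g_setdist M g x A = (INF z\<in>A. g_dist M g x z)"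

definition metric_deriv ::
    "(real^'n) set \<Rightarrow> 'n::finite metric \<Rightarrow> 'n \<Rightarrow> 'n \<Rightarrow> 'n \<Rightarrow> real^'n \<Rightarrow> real" where
  "metric_deriv M g i j l x = frechet_derivative (\<lambda>z. g z $ j $ l) (at x within M) (axis i 1)"

definition christoffel ::
    "(real^'n) set \<Rightarrow> 'n::finite metric \<Rightarrow> 'n \<Rightarrow> 'n \<Rightarrow> 'n \<Rightarrow> real^'n \<Rightarrow> real" where
  "christoffel M g k i j x = (1 / 2) * (\<Sum>l\<in>UNIV. matrix_inv (g x) $ k $ l *
     (metric_deriv M g i j l x + metric_deriv M g j i l x - metric_deriv M g l i j x))"

text \<open>\<open>\<gamma>\<close> is a unit speed geodesic of \<open>(M, g)\<close> on \<open>[0, T]\<close>, with velocity \<open>v\<close>.\<close>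

definition unit_speed_geodesic :: "(real^'n) set \<Rightarrow> 'n::finite metric \<Rightarrow> real \<Rightarrow>
    (real \<Rightarrow> real^'n) \<Rightarrow> (real \<Rightarrow> real^'n) \<Rightarrow> bool" where
  "unit_speed_geodesic M g T \<gamma> v \<longleftrightarrow> (\<forall>t\<in>{0..T}. \<gamma> t \<in> M \<and> g_norm g (\<gamma> t) (v t) = 1 \<and>
     (\<gamma> has_vector_derivative v t) (at t within {0..T}) \<and>
     (v has_vector_derivative
        (\<chi> k. - (\<Sum>i\<in>UNIV. \<Sum>j\<in>UNIV. christoffel M g k i j (\<gamma> t) * v t $ i * v t $ j)))
       (at t within {0..T}))"

section \<open>Boundary normal coordinates\<close>

text \<open>\<open>normal_geodesic M g y T \<gamma>\<close> says that \<open>\<gamma>(\<cdot>; y, \<nu>)\<close> is defined on \<open>[0, T]\<close>, where it equals \<open>\<gamma>\<close>.\<close>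

definition normal_geodesic :: "(real^'n) set \<Rightarrow> 'n::finite metric \<Rightarrow> real^'n \<Rightarrow> real \<Rightarrow>
    (real \<Rightarrow> real^'n) \<Rightarrow> bool" where
  "normal_geodesic M g y T \<gamma> \<longleftrightarrow> 0 \<le> T \<and> \<gamma> 0 = y \<and>
     (\<exists>v. v 0 = inward_unit_normal M g y \<and> unit_speed_geodesic M g T \<gamma> v)"

definition normal_map :: "(real^'n) set \<Rightarrow> 'n::finite metric \<Rightarrow> real^'n \<Rightarrow> real \<Rightarrow> real^'n" where
  "normal_map M g y s = (THE x. \<exists>\<gamma>. normal_geodesic M g y s \<gamma> \<and> \<gamma> s = x)"

text \<open>\<open>\<tau>\<^sub>M(y, \<nu>)\<close>: the first positive time at which the geodesic is on \<open>\<partial>M\<close>; \<open>\<infinity>\<close> if there is none.\<close>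

definition exit_time :: "(real^'n) set \<Rightarrow> 'n::finite metric \<Rightarrow> real^'n \<Rightarrow> ereal" where
  "exit_time M g y =
     Inf {ereal s |s. 0 < s \<and> (\<exists>\<gamma>. normal_geodesic M g y s \<gamma> \<and> \<gamma> s \<in> frontier M)}"

text \<open>\<open>\<sigma>\<^sub>\<Gamma>(y)\<close>. The maximum exists for \<open>y \<in> \<Gamma>\<close> on a smooth compact domain, where it is the
  supremum.\<close>

definition cut_distance ::
    "(real^'n) set \<Rightarrow> 'n::finite metric \<Rightarrow> (real^'n) set \<Rightarrow> real^'n \<Rightarrow> ereal" where
  "cut_distance M g \<Gamma> y = Sup {ereal s |s. 0 < s \<and> ereal s \<le> exit_time M g y \<and>
     (\<exists>\<gamma>. normal_geodesic M g y s \<gamma> \<and> g_setdist M g (\<gamma> s) \<Gamma> = ennreal s)}"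

definition normal_map_domain ::
    "(real^'n) set \<Rightarrow> 'n::finite metric \<Rightarrow> (real^'n) set \<Rightarrow> ((real^'n) \<times> real) set" where
  "normal_map_domain M g \<Gamma> = {(y, s). y \<in> \<Gamma> \<and> 0 \<le> s \<and> ereal s < cut_distance M g \<Gamma> y}"

section \<open>The operators \<open>H\<^sub>c\<close>\<close>

definition wave_speeds :: "(real^'n::finite) set \<Rightarrow> (real^'n \<Rightarrow> real) set" where
  "wave_speeds M = {c. smooth_on_domain M c \<and> (\<forall>x\<in>M. 0 < c x)}"

definition H_op :: "(real^'n::finite) set \<Rightarrow> (real^'n \<Rightarrow> real) \<Rightarrow> (real^'n \<Rightarrow> real) \<Rightarrow>
    (real^'n) \<times> real \<Rightarrow> real" where
  "H_op M c \<phi> = (\<lambda>(y, s). \<phi> (normal_map M (isotropic_metric c) y s))"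

text \<open>The \<open>C\<^sup>1\<close> norm on \<open>\<Gamma> \<times> [0, r)\<close>, for \<open>\<Gamma>\<close> open in \<open>\<partial>M\<close>, with respect to the product of the induced
  Euclidean metric on \<open>\<partial>M\<close> and \<open>ds\<^sup>2\<close>: the supremum of \<open>\<bar>f\<bar>\<close>, \<open>\<bar>\<partial>\<^sub>s f\<bar>\<close> and the length of the
  tangential gradient in \<open>y\<close>. The derivative within the hypersurface \<open>\<Gamma>\<close> is determined only on
  vectors tangent to \<open>\<partial>M\<close>, and is applied only to these.\<close>

definition C1_norm_cylinder :: "(real^'n::finite) set \<Rightarrow> (real^'n) set \<Rightarrow> real \<Rightarrow>
    ((real^'n) \<times> real \<Rightarrow> real) \<Rightarrow> ennreal" where
  "C1_norm_cylinder M \<Gamma> r f = (SUP (y, s)\<in>\<Gamma> \<times> {0..<r}.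
     Sup {ennreal \<bar>f (y, s)\<bar>,
       ennreal \<bar>vector_derivative (\<lambda>t. f (y, t)) (at s within {0..<r})\<bar>,
       (SUP w\<in>{w \<in> boundary_tangent_space M y. norm w \<le> 1}.
          ennreal \<bar>frechet_derivative (\<lambda>z. f (z, s)) (at y within \<Gamma>) w\<bar>)})"

definition H_diff_norm :: "(real^'n::finite) set \<Rightarrow> (real^'n) set \<Rightarrow> real \<Rightarrow>
    (real^'n \<Rightarrow> real) \<Rightarrow> (real^'n \<Rightarrow> real) \<Rightarrow> ennreal" where
  "H_diff_norm M \<Gamma> r c1 c2 = (SUP \<phi>\<in>{\<phi> \<in> harmonic_functions M. Ck_norm M 1 \<phi> \<le> 1}.
     C1_norm_cylinder M \<Gamma> r (\<lambda>p. H_op M c1 \<phi> p - H_op M c2 \<phi> p))"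

text \<open>A family of isotropic metrics is represented by the set of its wave speeds.\<close>

definition admissible_family :: "(real^'n::finite) set \<Rightarrow> (real^'n) set \<Rightarrow> (real^'n) set \<Rightarrow> real \<Rightarrow>
    (real^'n \<Rightarrow> real) set \<Rightarrow> bool" where
  "admissible_family M \<Gamma> \<Omega> r \<G> \<longleftrightarrow> \<G> \<subseteq> wave_speeds M \<and> (\<forall>c\<in>\<G>.
     \<Gamma> \<times> {0..<r} \<subseteq> normal_map_domain M (isotropic_metric c) \<Gamma> \<and>
     closure \<Omega> \<subseteq> (\<lambda>(y, s). normal_map M (isotropic_metric c) y s) ` (\<Gamma> \<times> {0..<r}))"

end

theory Submission
  imports Defs
begin

text \<open>Linear functions \<open>\<phi> x = x \<bullet> w\<close> are harmonic, and \<open>H\<^sub>c \<phi> (y, s)\<close> is then the component along \<open>w\<close> of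
  the point \<open>\<Phi>\<^sub>c(y, s)\<close> on the normal geodesic. Hence the operator norm \<open>N\<close> of \<open>H\<^bsub>c'\<^esub> - H\<^sub>c\<close> bounds,
  up to a constant depending only on the size of \<open>M\<close>, both \<open>\<bar>\<Phi>\<^bsub>c'\<^esub> - \<Phi>\<^sub>c\<bar>\<close> and
  \<open>\<bar>\<partial>\<^sub>s\<Phi>\<^bsub>c'\<^esub> - \<partial>\<^sub>s\<Phi>\<^sub>c\<bar>\<close> on \<open>\<Gamma> \<times> [0, r\<^sub>0)\<close> (\<open>normal_map_diff_bound\<close>).

  A unit speed geodesic of \<open>c\<^sup>-\<^sup>2dx\<^sup>2\<close> has Euclidean speed \<open>c\<close>, so the wave speed can be read off from the
  normal map: \<open>c(\<Phi>\<^sub>c(y, s)) = \<bar>\<partial>\<^sub>s\<Phi>\<^sub>c(y, s)\<bar>\<close>. Write \<open>x \<in> \<Omega>\<close> as \<open>x = \<Phi>\<^bsub>c'\<^esub>(y, s)\<close> and put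
  \<open>z = \<Phi>\<^sub>c(y, s)\<close>. Then \<open>\<bar>c'(x) - c(z)\<bar>\<close> is bounded by \<open>N\<close> because the velocities are close, and
  \<open>\<bar>c(z) - c(x)\<bar>\<close> is bounded by \<open>N\<close> because \<open>z\<close> is close to \<open>x\<close> and the fixed speed \<open>c\<close> is Lipschitz
  on \<open>M\<close> (\<open>pointwise_stability\<close>). Multiplying by \<open>c' + c\<close>, which is bounded because \<open>c'\<close> is uniformly
  close to \<open>c\<close>, gives the claim for the squares.

  For this reading of the normal map, \<open>\<Phi>\<^sub>c(y, \<cdot>)\<close> has to be one geodesic and not merely a choice of
  endpoints for each \<open>s\<close> (\<open>normal_map_trajectory\<close>). This rests on uniqueness for the geodesic
  equation, whose coefficients are Lipschitz: first derivatives within \<open>M\<close> are unique up to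
  the boundary, so the Christoffel symbols are those of a smooth extension of \<open>c\<close>, and smooth functions
  are Lipschitz on the compact set \<open>M\<close>.\<close>

section \<open>Lipschitz functions on compact sets\<close>

text \<open>The constant is hidden, so that the closure rules below apply to compound expressions without any
  bookkeeping of constants.\<close>

definition lipschitz_fun :: "'a::metric_space set \<Rightarrow> ('a \<Rightarrow> 'b::metric_space) \<Rightarrow> bool" where
  "lipschitz_fun S f \<longleftrightarrow> (\<exists>L. L-lipschitz_on S f)"

lemma lipschitz_fun_const: "lipschitz_fun S (\<lambda>x. a)"
  unfolding lipschitz_fun_def using lipschitz_on_constant by blast

lemma lipschitz_fun_add:
  fixes f g :: "'a::metric_space \<Rightarrow> 'b::real_normed_vector"
  assumes "lipschitz_fun S f" "lipschitz_fun S g"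
  shows "lipschitz_fun S (\<lambda>x. f x + g x)"
  using assms lipschitz_on_add unfolding lipschitz_fun_def by blast

lemma lipschitz_fun_minus:
  fixes f :: "'a::metric_space \<Rightarrow> 'b::real_normed_vector"
  assumes "lipschitz_fun S f"
  shows "lipschitz_fun S (\<lambda>x. - f x)"
  using assms lipschitz_on_minus unfolding lipschitz_fun_def by blast

lemma lipschitz_fun_diff:
  fixes f g :: "'a::metric_space \<Rightarrow> 'b::real_normed_vector"
  assumes "lipschitz_fun S f" "lipschitz_fun S g"
  shows "lipschitz_fun S (\<lambda>x. f x - g x)"
  using assms lipschitz_on_diff unfolding lipschitz_fun_def by blast

lemma lipschitz_fun_sum:
  fixes f :: "'i \<Rightarrow> 'a::metric_space \<Rightarrow> 'b::real_normed_vector"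
  assumes "\<And>i. i \<in> I \<Longrightarrow> lipschitz_fun S (f i)"
  shows "lipschitz_fun S (\<lambda>x. \<Sum>i\<in>I. f i x)"
  using assms
  by (induction I rule: infinite_finite_induct)
     (auto intro: lipschitz_fun_const lipschitz_fun_add)

lemma lipschitz_fun_cong:
  assumes "lipschitz_fun S f" "\<And>x. x \<in> S \<Longrightarrow> g x = f x"
  shows "lipschitz_fun S g"
  using assms lipschitz_on_transform[of _ S f g] unfolding lipschitz_fun_def by metis

lemma lipschitz_fun_linear:
  assumes "bounded_linear f"
  shows "lipschitz_fun S f"
  using bounded_linear.lipschitz_boundE[OF assms] unfolding lipschitz_fun_def by metis

lemma lipschitz_fun_compose:
  assumes "lipschitz_fun (f ` S) g" "lipschitz_fun S f"
  shows "lipschitz_fun S (\<lambda>x. g (f x))"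
  using assms lipschitz_on_compose2 unfolding lipschitz_fun_def by blast

lemma lipschitz_fun_subset:
  assumes "lipschitz_fun T f" "S \<subseteq> T"
  shows "lipschitz_fun S f"
  using assms lipschitz_on_subset unfolding lipschitz_fun_def by blast

lemma lipschitz_fun_bounded:
  fixes f :: "'a::metric_space \<Rightarrow> 'b::real_normed_vector"
  assumes "compact S" "lipschitz_fun S f"
  obtains B where "\<And>x. x \<in> S \<Longrightarrow> norm (f x) \<le> B"
proof -
  have "continuous_on S f"
    using assms(2) lipschitz_on_continuous_on unfolding lipschitz_fun_def by blast
  then have "bounded (f ` S)"
    using assms(1) compact_continuous_image compact_imp_bounded by blast
  then show ?thesis
    using that by (auto simp: bounded_iff)
qed

text \<open>Compactness makes both factors bounded, which is what the product rule for differences needs.\<close>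

lemma lipschitz_fun_mult:
  fixes f g :: "'a::metric_space \<Rightarrow> real"
  assumes "compact S" "lipschitz_fun S f" "lipschitz_fun S g"
  shows "lipschitz_fun S (\<lambda>x. f x * g x)"
proof -
  obtain L K where L: "L-lipschitz_on S f" and K: "K-lipschitz_on S g"
    using assms unfolding lipschitz_fun_def by blast
  obtain A where A: "\<And>x. x \<in> S \<Longrightarrow> \<bar>f x\<bar> \<le> A"
    using lipschitz_fun_bounded[OF assms(1,2)] by auto
  obtain B where B: "\<And>x. x \<in> S \<Longrightarrow> \<bar>g x\<bar> \<le> B"
    using lipschitz_fun_bounded[OF assms(1,3)] by auto
  have "(\<bar>A\<bar> * K + L * \<bar>B\<bar>)-lipschitz_on S (\<lambda>x. f x * g x)"
  proof (rule lipschitz_onI)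
    fix x y assume xy: "x \<in> S" "y \<in> S"
    have "\<bar>f x\<bar> \<le> \<bar>A\<bar>" "\<bar>g y\<bar> \<le> \<bar>B\<bar>"
      using A[OF xy(1)] B[OF xy(2)] by linarith+
    moreover have "\<bar>g x - g y\<bar> \<le> K * dist x y" "\<bar>f x - f y\<bar> \<le> L * dist x y"
      using lipschitz_onD[OF K xy] lipschitz_onD[OF L xy] by (auto simp: dist_real_def)
    ultimately have "\<bar>f x\<bar> * \<bar>g x - g y\<bar> + \<bar>f x - f y\<bar> * \<bar>g y\<bar>
        \<le> \<bar>A\<bar> * (K * dist x y) + (L * dist x y) * \<bar>B\<bar>"
      by (intro add_mono mult_mono) (auto intro: order_trans[OF abs_ge_zero])
    moreover have "f x * g x - f y * g y = f x * (g x - g y) + (f x - f y) * g y"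
      by (simp add: algebra_simps)
    then have "\<bar>f x * g x - f y * g y\<bar> \<le> \<bar>f x\<bar> * \<bar>g x - g y\<bar> + \<bar>f x - f y\<bar> * \<bar>g y\<bar>"
      by (metis abs_mult abs_triangle_ineq)
    ultimately show "dist (f x * g x) (f y * g y) \<le> (\<bar>A\<bar> * K + L * \<bar>B\<bar>) * dist x y"
      by (simp add: dist_real_def algebra_simps)
  next
    show "0 \<le> \<bar>A\<bar> * K + L * \<bar>B\<bar>"
      using lipschitz_on_nonneg[OF L] lipschitz_on_nonneg[OF K] by simp
  qed
  then show ?thesis
    unfolding lipschitz_fun_def by blast
qed

lemma lipschitz_fun_inverse:
  fixes f :: "'a::metric_space \<Rightarrow> real"
  assumes "compact S" "lipschitz_fun S f" "\<And>x. x \<in> S \<Longrightarrow> f x > 0"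
  shows "lipschitz_fun S (\<lambda>x. inverse (f x))"
proof (cases "S = {}")
  case True
  then show ?thesis
    unfolding lipschitz_fun_def by (auto intro: exI[of _ 0])
next
  case False
  obtain L where L: "L-lipschitz_on S f"
    using assms unfolding lipschitz_fun_def by blast
  obtain x0 where x0: "x0 \<in> S" "\<And>x. x \<in> S \<Longrightarrow> f x0 \<le> f x"
    using continuous_attains_inf[OF assms(1) False lipschitz_on_continuous_on[OF L]] by blast
  let ?m = "f x0"
  have m: "?m > 0" using assms(3) x0(1) by blast
  have "(L / ?m\<^sup>2)-lipschitz_on S (\<lambda>x. inverse (f x))"
  proof (rule lipschitz_onI)
    fix x y assume xy: "x \<in> S" "y \<in> S"
    have pos: "f x > 0" "f y > 0" using assms(3) xy by auto
    have "inverse (f x) - inverse (f y) = (f y - f x) / (f x * f y)"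
      using pos by (simp add: field_simps)
    then have "\<bar>inverse (f x) - inverse (f y)\<bar> = \<bar>f x - f y\<bar> / (f x * f y)"
      using pos by (simp add: abs_mult abs_minus_commute)
    also have "\<dots> \<le> (L * dist x y) / (?m * ?m)"
    proof (rule frac_le)
      show "\<bar>f x - f y\<bar> \<le> L * dist x y"
        using lipschitz_onD[OF L xy] by (simp add: dist_real_def)
      show "0 \<le> L * dist x y" using lipschitz_on_nonneg[OF L] by simp
      show "?m * ?m \<le> f x * f y"
        using x0(2)[OF xy(1)] x0(2)[OF xy(2)] m by (intro mult_mono) auto
    qed (use m in auto)
    finally show "dist (inverse (f x)) (inverse (f y)) \<le> (L / ?m\<^sup>2) * dist x y"
      by (simp add: dist_real_def power2_eq_square)
  qed (use lipschitz_on_nonneg[OF L] in simp)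
  then show ?thesis
    unfolding lipschitz_fun_def by blast
qed

lemma lipschitz_fun_Pair:
  assumes "lipschitz_fun S f" "lipschitz_fun S g"
  shows "lipschitz_fun S (\<lambda>x. (f x, g x))"
  using assms lipschitz_on_Pair unfolding lipschitz_fun_def by blast

lemma lipschitz_fun_vec:
  fixes f :: "'i::finite \<Rightarrow> 'a::metric_space \<Rightarrow> real"
  assumes "\<And>i. lipschitz_fun S (f i)"
  shows "lipschitz_fun S (\<lambda>x. \<chi> i. f i x)"
proof -
  have "bounded_linear (\<lambda>a::real. a *\<^sub>R (axis i 1 :: real^'i))" for i
    by (rule bounded_linear_scaleR_left)
  then have "lipschitz_fun S (\<lambda>x. \<Sum>i\<in>UNIV. f i x *\<^sub>R (axis i 1 :: real^'i))"
    by (intro lipschitz_fun_sum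
        lipschitz_fun_compose[where g = "\<lambda>a. a *\<^sub>R axis _ 1", OF lipschitz_fun_linear assms])
  moreover have "(\<Sum>i\<in>UNIV. f i x *\<^sub>R (axis i 1 :: real^'i)) = (\<chi> i. f i x)" for x
    by (simp add: vec_eq_iff axis_def if_distrib cong: if_cong)
  ultimately show ?thesis by simp
qed

lemma smooth_on_open_derivative:
  assumes "smooth_on_open U F" "vs \<in> lists Basis" "x \<in> U"
  shows "(iter_deriv U F vs has_derivative
           (\<lambda>h. h \<bullet> (\<Sum>b\<in>Basis. iter_deriv U F (b # vs) x *\<^sub>R b))) (at x)"
proof -
  let ?h = "iter_deriv U F vs"
  have U: "at x within U = at x"
    using assms unfolding smooth_on_open_def by (intro at_within_open) auto
  have D: "(?h has_derivative frechet_derivative ?h (at x)) (at x)"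
    using assms frechet_derivative_works unfolding smooth_on_open_def by blast
  then have lin: "linear (frechet_derivative ?h (at x))"
    by (rule has_derivative_linear)
  have "frechet_derivative ?h (at x) v
      = v \<bullet> (\<Sum>b\<in>Basis. iter_deriv U F (b # vs) x *\<^sub>R b)" for v
  proof -
    have "frechet_derivative ?h (at x) v
        = frechet_derivative ?h (at x) (\<Sum>b\<in>Basis. (v \<bullet> b) *\<^sub>R b)"
      by (simp add: euclidean_representation)
    also have "\<dots> = (\<Sum>b\<in>Basis. (v \<bullet> b) * frechet_derivative ?h (at x) b)"
      by (simp add: linear_sum[OF lin] linear_cmul[OF lin])
    finally show ?thesis
      by (simp add: inner_sum_right U mult.commute)
  qed
  then have "frechet_derivative ?h (at x)
      = (\<lambda>h. h \<bullet> (\<Sum>b\<in>Basis. iter_deriv U F (b # vs) x *\<^sub>R b))"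
    by blast
  then show ?thesis using D by metis
qed

text \<open>The gradient is locally bounded, so the mean value theorem applies on small balls; compactness
  passes from local to global even where segments between points of \<open>M\<close> leave it.\<close>

lemma smooth_imp_lipschitz:
  assumes F: "smooth_on_open U F" and vs: "vs \<in> lists Basis" and M: "compact M" "M \<subseteq> U"
  shows "lipschitz_fun M (iter_deriv U F vs)"
proof -
  let ?h = "iter_deriv U F vs"
  let ?G = "\<lambda>x. \<Sum>b\<in>Basis. iter_deriv U F (b # vs) x *\<^sub>R b"
  have "open U" using F unfolding smooth_on_open_def by blast
  have "iter_deriv U F ws differentiable at x" if "ws \<in> lists Basis" "x \<in> U" for ws x
    using F that unfolding smooth_on_open_def by blast
  then have "continuous_on U (iter_deriv U F ws)" if "ws \<in> lists Basis" for ws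
    using that
    by (meson continuous_at_imp_continuous_on differentiable_imp_continuous_within)
  then have contG: "continuous_on U ?G"
    using vs by (intro continuous_intros) (auto simp del: iter_deriv.simps)
  \<comment> \<open>The dummy time variable ranges over a single point.\<close>
  have "local_lipschitz {0::real} U (\<lambda>_. ?h)"
  proof (rule local_lipschitzI)
    fix t :: real and x assume "x \<in> U"
    then obtain u where u: "u > 0" "cball x u \<subseteq> U"
      using \<open>open U\<close> open_contains_cball by blast
    have "bounded (?G ` cball x u)"
      using u contG by (intro compact_imp_bounded compact_continuous_image)
        (auto intro: continuous_on_subset)
    then obtain B where B: "\<And>z. z \<in> cball x u \<Longrightarrow> norm (?G z) \<le> B"
      unfolding bounded_iff by blast
    have "B-lipschitz_on (cball x u) ?h"
    proof (rule bounded_derivative_imp_lipschitz)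
      fix z assume z: "z \<in> cball x u"
      show "(?h has_derivative (\<lambda>h. h \<bullet> ?G z)) (at z within cball x u)"
        using smooth_on_open_derivative[OF F vs, of z] z u(2) has_derivative_at_withinI by blast
      have "norm (h \<bullet> ?G z) \<le> B * norm h" for h
        using Cauchy_Schwarz_ineq2[of h "?G z"] mult_left_mono[OF B[OF z], of "norm h"]
        by (simp add: mult.commute)
      then show "onorm (\<lambda>h. h \<bullet> ?G z) \<le> B"
        by (rule onorm_le)
    next
      have "norm (?G x) \<le> B" using u(1) by (intro B) simp
      then show "0 \<le> B" by (rule order_trans[OF norm_ge_zero])
    qed (rule convex_cball)
    then show "\<exists>u>0. \<exists>L. \<forall>t\<in>cball t u \<inter> {0}. L-lipschitz_on (cball x u \<inter> U) ?h"
      using u by (intro exI[of _ u] conjI exI[of _ B]) (auto intro: lipschitz_on_subset)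
  qed
  then have "local_lipschitz {0::real} M (\<lambda>_. ?h)"
    using M(2) by (rule local_lipschitz_subset[OF _ order_refl])
  then obtain L where "\<And>t. t \<in> {0::real} \<Longrightarrow> L-lipschitz_on M ?h"
    using M(1) by (elim local_lipschitz_compact_implies_lipschitz) auto
  then show ?thesis
    unfolding lipschitz_fun_def by blast
qed

section \<open>Derivatives within a domain with smooth boundary\<close>

lemma derivative_within_unique_direction:
  fixes f :: "'a::real_normed_vector \<Rightarrow> 'b::real_normed_vector"
  assumes f': "(f has_derivative f') (at x within M)"
    and f'': "(f has_derivative f'') (at x within M)"
    and d: "0 < d" "\<And>t. 0 \<le> t \<Longrightarrow> t < d \<Longrightarrow> x + t *\<^sub>R w \<in> M"
  shows "f' w = f'' w"
proof -
  have *: "((\<lambda>t. f (x + t *\<^sub>R w)) has_vector_derivative g w) (at 0 within {0..<d})"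
    if g: "(f has_derivative g) (at x within M)" for g
  proof -
    have "((\<lambda>t. x + t *\<^sub>R w) has_derivative (\<lambda>t. t *\<^sub>R w)) (at 0 within {0..<d})"
      by (auto intro!: derivative_eq_intros)
    moreover have "(f has_derivative g) (at (x + 0 *\<^sub>R w) within (\<lambda>t. x + t *\<^sub>R w) ` {0..<d})"
      using g d(2) by (auto intro: has_derivative_subset)
    ultimately have "((\<lambda>t. f (x + t *\<^sub>R w)) has_derivative (\<lambda>t. g (t *\<^sub>R w))) (at 0 within {0..<d})"
      by (rule has_derivative_in_compose)
    then show ?thesis
      unfolding has_vector_derivative_def
      using has_derivative_linear[OF g] by (simp add: linear_cmul)
  qed
  have "at 0 within {0..<d} \<noteq> bot"
    using d(1) by (simp add: trivial_limit_within islimpt_Ico)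
  then show ?thesis
    using vector_derivative_unique_within *[OF f'] *[OF f''] by blast
qed

text \<open>At a boundary point, the directions \<open>w\<close> with \<open>d\<rho>(w) < 0\<close> enter \<open>M\<close> for a short time, which
  determines the derivative on them. They form a nonempty open half space, and hence span everything.\<close>

lemma smooth_compact_domain_derivative_unique:
  fixes f :: "'a::euclidean_space \<Rightarrow> 'b::real_normed_vector"
  assumes M: "smooth_compact_domain M" and x: "x \<in> M"
    and f': "(f has_derivative f') (at x within M)"
    and f'': "(f has_derivative f'') (at x within M)"
  shows "f' = f''"
proof (cases "x \<in> frontier M")
  case False
  have "x \<in> interior M"
    using False x closure_subset unfolding frontier_def by auto
  then have "at x within M = at x" by (rule at_within_interior)
  then show ?thesis using f' f'' has_derivative_unique by metis
next
  case True
  then obtain U \<rho> where b: "boundary_defining_function M x U \<rho>"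
    using M unfolding smooth_compact_domain_def by blast
  let ?\<rho>' = "frechet_derivative \<rho> (at x)"
  have U: "x \<in> U" "open U" and \<rho>: "\<rho> x \<le> 0" "M \<inter> U = {x \<in> U. \<rho> x \<le> 0}"
    and nz: "\<exists>w. ?\<rho>' w \<noteq> 0" and sm: "smooth_on_open U \<rho>"
    using b x unfolding boundary_defining_function_def smooth_on_open_def by auto
  have "iter_deriv U \<rho> [] differentiable at x"
    using sm U(1) unfolding smooth_on_open_def by blast
  then have D: "(\<rho> has_derivative ?\<rho>') (at x)"
    by (simp add: frechet_derivative_works)
  then have lin: "linear ?\<rho>'" by (rule has_derivative_linear)
  have lin': "linear f'" "linear f''"
    using f' f'' has_derivative_linear by blast+
  have down: "f' w = f'' w" if w: "?\<rho>' w < 0" for w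
  proof -
    have "((\<lambda>t. x + t *\<^sub>R w) has_derivative (\<lambda>t. t *\<^sub>R w)) (at 0)"
      by (auto intro!: derivative_eq_intros)
    then have "((\<lambda>t. \<rho> (x + t *\<^sub>R w)) has_derivative (\<lambda>t. ?\<rho>' (t *\<^sub>R w))) (at 0)"
      by (rule has_derivative_compose) (simp add: D)
    then have "((\<lambda>t. \<rho> (x + t *\<^sub>R w)) has_real_derivative ?\<rho>' w) (at 0)"
      unfolding has_field_derivative_def by (simp add: linear_cmul[OF lin] mult_commute_abs)
    from DERIV_neg_dec_right[OF this w] obtain d
      where d: "d > 0" "\<And>h. 0 < h \<Longrightarrow> h < d \<Longrightarrow> \<rho> (x + h *\<^sub>R w) < \<rho> x" by auto
    obtain e where e: "e > 0" "ball x e \<subseteq> U" using U openE by blast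
    \<comment> \<open>Before time \<open>k\<close> the ray has neither left \<open>U\<close> nor returned to the level of its starting point.\<close>
    define k where "k = min d (e / (norm w + 1))"
    have nw: "norm w + 1 > 0" using norm_ge_zero[of w] by linarith
    have "k > 0" using d(1) e(1) nw by (simp add: k_def)
    moreover have "x + t *\<^sub>R w \<in> M" if t: "0 \<le> t" "t < k" for t
    proof (cases "t = 0")
      case False
      have "t * norm w \<le> t * (norm w + 1)" using t by (intro mult_left_mono) auto
      also have "\<dots> < e"
        using t nw by (simp add: k_def less_divide_eq)
      finally have "x + t *\<^sub>R w \<in> U" using e t by (auto simp: dist_norm)
      moreover have "\<rho> (x + t *\<^sub>R w) \<le> 0"
        using d(2)[of t] False t \<rho>(1) by (simp add: k_def)
      ultimately show ?thesis using \<rho>(2) by auto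
    qed (use x in simp)
    ultimately show ?thesis
      using derivative_within_unique_direction[OF f' f''] by blast
  qed
  obtain w0 where w0: "?\<rho>' w0 < 0"
  proof -
    obtain w where "?\<rho>' w \<noteq> 0" using nz by blast
    then have "?\<rho>' w < 0 \<or> ?\<rho>' (- w) < 0" using linear_neg[OF lin] by auto
    then show ?thesis using that by blast
  qed
  show ?thesis
  proof
    fix w
    \<comment> \<open>A multiple of \<open>w\<^sub>0\<close> that is large enough to push \<open>w\<close> into the half space of inward directions.\<close>
    define k where "k = (\<bar>?\<rho>' w\<bar> + 1) / (- ?\<rho>' w0)"
    have "k * ?\<rho>' w0 = - (\<bar>?\<rho>' w\<bar> + 1)" using w0 by (simp add: k_def field_simps)
    then have "?\<rho>' (w + k *\<^sub>R w0) < 0"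
      by (simp add: linear_add[OF lin] linear_cmul[OF lin])
    from down[OF this] down[OF w0] show "f' w = f'' w"
      by (simp add: linear_add[OF lin'(1)] linear_cmul[OF lin'(1)]
          linear_add[OF lin'(2)] linear_cmul[OF lin'(2)])
  qed
qed

lemma frechet_derivative_within_domain:
  assumes "smooth_compact_domain M" "x \<in> M" "(f has_derivative f') (at x within M)"
  shows "frechet_derivative f (at x within M) = f'"
  using smooth_compact_domain_derivative_unique[OF assms(1,2) _ assms(3)] assms(3)
    frechet_derivative_works differentiable_def by metis

section \<open>Uniqueness of geodesics\<close>

text \<open>Gronwall's argument: \<open>exp (- 2 L t) \<bar>z t - w t\<bar>\<^sup>2\<close> does not increase, and it starts at \<open>0\<close>.\<close>

lemma autonomous_ODE_unique:
  fixes z w :: "real \<Rightarrow> 'a::real_inner"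
  assumes F: "lipschitz_fun S F"
    and z: "\<And>t. t \<in> {0..T} \<Longrightarrow> z t \<in> S \<and> (z has_vector_derivative F (z t)) (at t within {0..T})"
    and w: "\<And>t. t \<in> {0..T} \<Longrightarrow> w t \<in> S \<and> (w has_vector_derivative F (w t)) (at t within {0..T})"
    and init: "z 0 = w 0" and t: "t \<in> {0..T}"
  shows "z t = w t"
proof -
  obtain L where L: "L-lipschitz_on S F" using F unfolding lipschitz_fun_def by blast
  define u where "u t = exp (- (2 * L) * t) * ((z t - w t) \<bullet> (z t - w t))" for t
  define u' where "u' t = exp (- (2 * L) * t) *
      (2 * ((z t - w t) \<bullet> (F (z t) - F (w t))) - 2 * L * ((z t - w t) \<bullet> (z t - w t)))" for t
  have du: "(u has_real_derivative u' s) (at s within {0..T})" if s: "s \<in> {0..T}" for s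
  proof -
    have d: "((\<lambda>t. z t - w t) has_derivative (\<lambda>h. h *\<^sub>R (F (z s) - F (w s)))) (at s within {0..T})"
      using z[OF s] w[OF s] has_vector_derivative_diff
      unfolding has_vector_derivative_def[symmetric] by blast
    show ?thesis
      unfolding u_def u'_def has_field_derivative_def
      by (rule derivative_eq_intros d refl | simp add: fun_eq_iff algebra_simps inner_commute)+
  qed
  have le: "u' s \<le> 0" if s: "s \<in> {0..T}" for s
  proof -
    have "(z s - w s) \<bullet> (F (z s) - F (w s)) \<le> norm (z s - w s) * norm (F (z s) - F (w s))"
      by (rule norm_cauchy_schwarz)
    also have "\<dots> \<le> norm (z s - w s) * (L * norm (z s - w s))"
      using lipschitz_on_normD[OF L] z[OF s] w[OF s] by (intro mult_left_mono) auto
    finally have "2 * ((z s - w s) \<bullet> (F (z s) - F (w s)))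
        - 2 * L * ((z s - w s) \<bullet> (z s - w s)) \<le> 0"
      by (simp add: dot_square_norm power2_eq_square mult.left_commute)
    then show ?thesis
      unfolding u'_def by (rule mult_nonneg_nonpos[OF exp_ge_zero])
  qed
  have "u t \<le> u 0"
  proof (rule DERIV_nonpos_imp_decreasing_open[of 0 t u])
    show "0 \<le> t" using t by simp
  next
    fix s assume s: "0 < s" "s < t"
    then have sT: "s \<in> interior {0..T}" "s \<in> {0..T}" using t by auto
    show "\<exists>y. (u has_real_derivative y) (at s) \<and> y \<le> 0"
      using du[OF sT(2)] le[OF sT(2)] unfolding at_within_interior[OF sT(1)] by blast
  next
    have "continuous_on {0..T} u"
      by (rule DERIV_continuous_on[OF du])
    then show "continuous_on {0..t} u" using t by (auto intro: continuous_on_subset)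
  qed
  then have "(z t - w t) \<bullet> (z t - w t) \<le> 0"
    using init by (simp add: u_def mult_le_0_iff)
  then show ?thesis
    using inner_gt_zero_iff[of "z t - w t"] by (metis eq_iff_diff_eq_0 not_less)
qed

lemma isotropic_metric_nth:
  "isotropic_metric c x $ j $ l = (if j = l then inverse ((c x)\<^sup>2) else 0)"
  by (simp add: isotropic_metric_def mat_def inverse_eq_divide)

lemma matrix_inv_isotropic_metric:
  assumes "c x \<noteq> 0"
  shows "matrix_inv (isotropic_metric c x) = (c x)\<^sup>2 *\<^sub>R mat 1"
proof -
  let ?A = "isotropic_metric c x" and ?B = "(c x)\<^sup>2 *\<^sub>R mat 1 :: real^'n^'n"
  have inv: "?A ** ?B = mat 1" "?B ** ?A = mat 1"
    using assms
    by (simp_all add: isotropic_metric_def matrix_scalar_ac flip: scalar_matrix_assoc)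
  then have "\<exists>A'. ?A ** A' = mat 1 \<and> A' ** ?A = mat 1" by blast
  then have "?A ** matrix_inv ?A = mat 1"
    unfolding matrix_inv_def by (rule someI2_ex) blast
  then have "?B ** (?A ** matrix_inv ?A) = ?B" by simp
  then show ?thesis by (simp add: matrix_mul_assoc inv)
qed

lemma g_norm_isotropic:
  assumes "0 < c x"
  shows "g_norm (isotropic_metric c) x v = norm v / c x"
proof -
  have "isotropic_metric c x *v v = (1 / (c x)\<^sup>2) *\<^sub>R v"
    by (simp add: isotropic_metric_def scaleR_matrix_vector_assoc[symmetric])
  then have "g_inner (isotropic_metric c) x v v = (norm v)\<^sup>2 / (c x)\<^sup>2"
    by (simp add: g_inner_def dot_square_norm)
  then show ?thesis
    using assms by (simp add: g_norm_def real_sqrt_divide)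
qed

lemma wave_speed_extension:
  assumes "c \<in> wave_speeds M"
  obtains U C where "M \<subseteq> U" "smooth_on_open U C" "\<And>x. x \<in> M \<Longrightarrow> C x = c x"
  using assms unfolding wave_speeds_def smooth_on_domain_def by blast

lemma wave_speed_lipschitz:
  assumes "compact M" "c \<in> wave_speeds M"
  shows "lipschitz_fun M c"
proof -
  obtain U C where C: "M \<subseteq> U" "smooth_on_open U C" "\<And>x. x \<in> M \<Longrightarrow> C x = c x"
    using wave_speed_extension[OF assms(2)] by metis
  have "lipschitz_fun M (iter_deriv U C [])"
    using C assms(1) by (intro smooth_imp_lipschitz) auto
  then show ?thesis
    by (rule lipschitz_fun_cong) (simp add: C)
qed

text \<open>Since derivatives within \<open>M\<close> are unique, the partial derivatives of \<open>c\<^sup>-\<^sup>2\<close> agree on \<open>M\<close> with those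
  computed from an extension \<open>C\<close> of \<open>c\<close> that is smooth on an open set.\<close>

lemma metric_deriv_isotropic_lipschitz:
  fixes c :: "real^'n::finite \<Rightarrow> real"
  assumes M: "smooth_compact_domain M" and c: "c \<in> wave_speeds M"
  shows "lipschitz_fun M (metric_deriv M (isotropic_metric c) i j l)"
proof (cases "j = l")
  case False
  have "metric_deriv M (isotropic_metric c) i j l x = 0" if "x \<in> M" for x
    using frechet_derivative_within_domain[OF M that has_derivative_const[of "0::real"]] False
    unfolding metric_deriv_def isotropic_metric_nth by simp
  then show ?thesis
    by (rule lipschitz_fun_cong[OF lipschitz_fun_const])
next
  case True
  have compact: "compact M" using M unfolding smooth_compact_domain_def by blast
  have pos: "\<And>x. x \<in> M \<Longrightarrow> 0 < c x" using c unfolding wave_speeds_def by blast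
  obtain U C where C: "M \<subseteq> U" "smooth_on_open U C" "\<And>x. x \<in> M \<Longrightarrow> C x = c x"
    using wave_speed_extension[OF c] by metis
  let ?D = "iter_deriv U C [axis i 1]"
  have "metric_deriv M (isotropic_metric c) i j l x
      = - 2 * (inverse (c x) * inverse (c x) * inverse (c x) * ?D x)" if x: "x \<in> M" for x
  proof -
    have U: "x \<in> U" "open U" using x C(1,2) unfolding smooth_on_open_def by auto
    have nz: "C x \<noteq> 0" using pos[OF x] C(3)[OF x] by simp
    let ?C' = "frechet_derivative C (at x)"
    have "iter_deriv U C [] differentiable at x"
      using C(2) U(1) unfolding smooth_on_open_def by blast
    then have "(C has_derivative ?C') (at x within M)"
      by (simp add: frechet_derivative_works has_derivative_at_withinI)
    from Deriv.has_derivative_inverse[OF nz this]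
    have inv: "((\<lambda>z. inverse (C z)) has_derivative
        (\<lambda>h. - (inverse (C x) * ?C' h * inverse (C x)))) (at x within M)" .
    have "((\<lambda>z. inverse (C z) * inverse (C z)) has_derivative
        (\<lambda>h. - 2 * (inverse (C x) * inverse (C x) * inverse (C x) * ?C' h))) (at x within M)"
      by (rule has_derivative_eq_rhs[OF has_derivative_mult[OF inv inv]])
         (simp add: fun_eq_iff algebra_simps)
    then have "((\<lambda>z. isotropic_metric c z $ j $ l) has_derivative
        (\<lambda>h. - 2 * (inverse (C x) * inverse (C x) * inverse (C x) * ?C' h))) (at x within M)"
      by (rule has_derivative_transform[OF x, rotated])
         (simp add: isotropic_metric_nth True C(3) power2_eq_square)
    from frechet_derivative_within_domain[OF M x this]
    show ?thesis
      by (simp add: metric_deriv_def at_within_open[OF U] C(3)[OF x])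
  qed
  moreover have "lipschitz_fun M ?D"
    using C(1,2) compact by (intro smooth_imp_lipschitz) (auto simp: axis_in_Basis_iff)
  then have "lipschitz_fun M
      (\<lambda>x. - 2 * (inverse (c x) * inverse (c x) * inverse (c x) * ?D x))"
    using wave_speed_lipschitz[OF compact c]
    by (intro lipschitz_fun_mult lipschitz_fun_inverse lipschitz_fun_const compact pos)
  ultimately show ?thesis
    by (rule lipschitz_fun_cong[rotated])
qed

lemma christoffel_isotropic_lipschitz:
  fixes c :: "real^'n::finite \<Rightarrow> real"
  assumes M: "smooth_compact_domain M" and c: "c \<in> wave_speeds M"
  shows "lipschitz_fun M (christoffel M (isotropic_metric c) k i j)"
proof -
  let ?g = "isotropic_metric c"
  have compact: "compact M" using M unfolding smooth_compact_domain_def by blast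
  have inv: "matrix_inv (?g x) $ k $ l = c x * c x * mat 1 $ k $ l" if "x \<in> M" for x l
  proof -
    have "c x \<noteq> 0" using that c unfolding wave_speeds_def by force
    from matrix_inv_isotropic_metric[of c x, OF this] show ?thesis
      by (simp add: power2_eq_square)
  qed
  have "lipschitz_fun M (\<lambda>x. 1 / 2 * (\<Sum>l\<in>UNIV. c x * c x * mat 1 $ k $ l *
      (metric_deriv M ?g i j l x + metric_deriv M ?g j i l x - metric_deriv M ?g l i j x)))"
    by (intro lipschitz_fun_mult lipschitz_fun_sum lipschitz_fun_add lipschitz_fun_diff
        lipschitz_fun_const wave_speed_lipschitz metric_deriv_isotropic_lipschitz compact M c)
  then show ?thesis
    by (rule lipschitz_fun_cong) (simp add: christoffel_def inv)
qed

text \<open>The second-order geodesic equation as a first-order system for position and velocity.\<close>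

definition geodesic_field ::
    "(real^'n) set \<Rightarrow> 'n::finite metric \<Rightarrow> (real^'n) \<times> (real^'n) \<Rightarrow> (real^'n) \<times> (real^'n)" where
  "geodesic_field M g p = (snd p, \<chi> k. - (\<Sum>i\<in>UNIV. \<Sum>j\<in>UNIV.
     christoffel M g k i j (fst p) * snd p $ i * snd p $ j))"

text \<open>The field is quadratic in the velocity, so a Lipschitz bound needs bounded velocities. Geodesics of
  unit speed stay in such a set, their Euclidean speed being \<open>c\<close>.\<close>

lemma geodesic_field_lipschitz:
  fixes c :: "real^'n::finite \<Rightarrow> real"
  assumes M: "smooth_compact_domain M" and c: "c \<in> wave_speeds M"
  shows "lipschitz_fun (M \<times> cball 0 B) (geodesic_field M (isotropic_metric c))"
proof -
  let ?S = "M \<times> cball (0::real^'n) B"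
  have compact: "compact ?S"
    using M unfolding smooth_compact_domain_def by (intro compact_Times) auto
  have christoffel: "lipschitz_fun ?S (\<lambda>p. christoffel M (isotropic_metric c) k i j (fst p))" for k i j
    by (rule lipschitz_fun_compose)
       (auto intro: lipschitz_fun_subset[OF christoffel_isotropic_lipschitz[OF M c]]
          lipschitz_fun_linear bounded_linear_fst)
  have component: "lipschitz_fun ?S (\<lambda>p. snd p $ i)" for i
    by (intro lipschitz_fun_linear bounded_linear_compose[OF bounded_linear_vec_nth bounded_linear_snd])
  show ?thesis
    unfolding geodesic_field_def[abs_def]
    by (intro lipschitz_fun_Pair lipschitz_fun_vec lipschitz_fun_minus lipschitz_fun_sum
        lipschitz_fun_mult christoffel component compact lipschitz_fun_linear bounded_linear_snd)
qed

lemma unit_speed_geodesic_isotropicD: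
  assumes c: "c \<in> wave_speeds M" and geo: "unit_speed_geodesic M (isotropic_metric c) T \<gamma> v"
    and t: "t \<in> {0..T}"
  shows "\<gamma> t \<in> M" and "norm (v t) = c (\<gamma> t)"
    and "(\<gamma> has_vector_derivative v t) (at t within {0..T})"
    and "((\<lambda>t. (\<gamma> t, v t)) has_vector_derivative
           geodesic_field M (isotropic_metric c) (\<gamma> t, v t)) (at t within {0..T})"
proof -
  show "\<gamma> t \<in> M" "(\<gamma> has_vector_derivative v t) (at t within {0..T})"
    using geo t unfolding unit_speed_geodesic_def by blast+
  have pos: "0 < c (\<gamma> t)"
    using c \<open>\<gamma> t \<in> M\<close> unfolding wave_speeds_def by blast
  have "g_norm (isotropic_metric c) (\<gamma> t) (v t) = 1"
    using geo t unfolding unit_speed_geodesic_def by blast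
  then show "norm (v t) = c (\<gamma> t)"
    using pos by (simp add: g_norm_isotropic)
  show "((\<lambda>t. (\<gamma> t, v t)) has_vector_derivative
      geodesic_field M (isotropic_metric c) (\<gamma> t, v t)) (at t within {0..T})"
    using geo t unfolding unit_speed_geodesic_def geodesic_field_def fst_conv snd_conv
    by (intro has_vector_derivative_Pair) blast+
qed

lemma unit_speed_geodesic_unique:
  fixes c :: "real^'n::finite \<Rightarrow> real"
  assumes M: "smooth_compact_domain M" and c: "c \<in> wave_speeds M"
    and geo1: "unit_speed_geodesic M (isotropic_metric c) T \<gamma>1 v1"
    and geo2: "unit_speed_geodesic M (isotropic_metric c) T \<gamma>2 v2"
    and init: "\<gamma>1 0 = \<gamma>2 0" "v1 0 = v2 0" and t: "t \<in> {0..T}"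
  shows "\<gamma>1 t = \<gamma>2 t"
proof -
  have "compact M" using M unfolding smooth_compact_domain_def by blast
  then obtain B where B: "\<And>x. x \<in> M \<Longrightarrow> \<bar>c x\<bar> \<le> B"
    using lipschitz_fun_bounded[OF _ wave_speed_lipschitz[OF _ c]] by auto
  let ?S = "M \<times> cball (0::real^'n) B"
  have state: "(\<gamma> t, v t) \<in> ?S \<and> ((\<lambda>t. (\<gamma> t, v t)) has_vector_derivative
      geodesic_field M (isotropic_metric c) (\<gamma> t, v t)) (at t within {0..T})"
    if "unit_speed_geodesic M (isotropic_metric c) T \<gamma> v" "t \<in> {0..T}" for \<gamma> v t
    using unit_speed_geodesic_isotropicD[OF c that] B[of "\<gamma> t"] by auto
  have "(\<gamma>1 0, v1 0) = (\<gamma>2 0, v2 0)" using init by simp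
  from autonomous_ODE_unique[OF geodesic_field_lipschitz[OF M c]
      state[OF geo1] state[OF geo2] this t]
  have "(\<gamma>1 t, v1 t) = (\<gamma>2 t, v2 t)" .
  then show ?thesis by simp
qed

section \<open>The normal map along a geodesic\<close>

lemma unit_speed_geodesic_restrict:
  assumes "unit_speed_geodesic M g T \<gamma> v" "t \<le> T"
  shows "unit_speed_geodesic M g t \<gamma> v"
proof -
  have "{0..t} \<subseteq> {0..T}" using assms(2) by auto
  then show ?thesis
    using assms(1) unfolding unit_speed_geodesic_def
    by (blast intro: has_vector_derivative_within_subset)
qed

lemma normal_map_eq:
  fixes c :: "real^'n::finite \<Rightarrow> real"
  assumes M: "smooth_compact_domain M" and c: "c \<in> wave_speeds M"
    and geo: "normal_geodesic M (isotropic_metric c) y T \<gamma>" and t: "t \<in> {0..T}"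
  shows "normal_map M (isotropic_metric c) y t = \<gamma> t"
  unfolding normal_map_def
proof (rule the_equality)
  have "normal_geodesic M (isotropic_metric c) y t \<gamma>"
    using geo t unit_speed_geodesic_restrict unfolding normal_geodesic_def
    by (metis atLeastAtMost_iff)
  then show "\<exists>\<gamma>'. normal_geodesic M (isotropic_metric c) y t \<gamma>' \<and> \<gamma>' t = \<gamma> t"
    by blast
  fix x assume "\<exists>\<gamma>'. normal_geodesic M (isotropic_metric c) y t \<gamma>' \<and> \<gamma>' t = x"
  then obtain \<gamma>' where \<gamma>': "normal_geodesic M (isotropic_metric c) y t \<gamma>'" "\<gamma>' t = x"
    by blast
  have "\<gamma>' t = \<gamma> t"
    using \<gamma>'(1) \<open>normal_geodesic M (isotropic_metric c) y t \<gamma>\<close> t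
    unfolding normal_geodesic_def
    by (auto intro: unit_speed_geodesic_unique[OF M c])
  then show "x = \<gamma> t" using \<gamma>'(2) by simp
qed

text \<open>The strict inequality \<open>s < \<sigma>\<^sub>\<Gamma>(y)\<close> leaves room for a geodesic that extends beyond \<open>s\<close>. It represents
  the normal map on a neighbourhood of \<open>s\<close> in \<open>[0, r)\<close>, so that derivatives in \<open>s\<close> can be taken along it.\<close>

lemma normal_map_trajectory:
  fixes c :: "real^'n::finite \<Rightarrow> real"
  assumes M: "smooth_compact_domain M" and c: "c \<in> wave_speeds M"
    and dom: "(y, s) \<in> normal_map_domain M (isotropic_metric c) \<Gamma>" and r: "s < r"
  obtains v where "normal_map M (isotropic_metric c) y s \<in> M"
    and "norm v = c (normal_map M (isotropic_metric c) y s)"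
    and "(normal_map M (isotropic_metric c) y has_vector_derivative v) (at s within {0..<r})"
proof -
  let ?g = "isotropic_metric c"
  have s: "0 \<le> s" "ereal s < cut_distance M ?g \<Gamma> y"
    using dom unfolding normal_map_domain_def by auto
  then obtain T \<gamma> where T: "s < T" and geo: "normal_geodesic M ?g y T \<gamma>"
    unfolding cut_distance_def less_Sup_iff by auto
  then obtain v where v: "unit_speed_geodesic M ?g T \<gamma> v"
    unfolding normal_geodesic_def by blast
  have sT: "s \<in> {0..T}" using s T by simp
  note eq = normal_map_eq[OF M c geo]
  note D = unit_speed_geodesic_isotropicD[OF c v sT]
  have "(normal_map M ?g y has_vector_derivative v s) (at s within {0..T})"
    using has_vector_derivative_transform[OF sT eq D(3)] .
  then have "(normal_map M ?g y has_vector_derivative v s) (at s within {0..<min T r})"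
    by (rule has_vector_derivative_within_subset) auto
  also have "at s within {0..<min T r} = at s within {0..<r}"
    using T by (intro at_within_nhd[of s "{..<T}"]) auto
  finally show ?thesis
    using that D(1,2) eq[OF sT] by simp
qed

section \<open>Linear functions as test functions\<close>

text \<open>The affine form, with a constant term, is preserved by differentiation; it covers all orders at once.\<close>

lemma iter_deriv_linear_UNIV:
  fixes w :: "'a::euclidean_space"
  shows "\<exists>u a. iter_deriv UNIV (\<lambda>x. x \<bullet> w) vs = (\<lambda>x. x \<bullet> u + a)"
proof (induction vs)
  case Nil
  show ?case by (intro exI[of _ w] exI[of _ "0::real"]) simp
next
  case (Cons v vs)
  then obtain u a where eq: "iter_deriv UNIV (\<lambda>x. x \<bullet> w) vs = (\<lambda>x. x \<bullet> u + a)" by blast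
  have "((\<lambda>x. x \<bullet> u + a) has_derivative (\<lambda>h. h \<bullet> u)) (at x)" for x
    by (auto intro!: derivative_eq_intros)
  then have "frechet_derivative (\<lambda>x. x \<bullet> u + a) (at x) = (\<lambda>h. h \<bullet> u)" for x
    using frechet_derivative_at by metis
  then have "iter_deriv UNIV (\<lambda>x. x \<bullet> w) (v # vs) = (\<lambda>x. x \<bullet> 0 + v \<bullet> u)"
    by (simp add: eq)
  then show ?case by blast
qed

lemma iter_deriv_linear_domain:
  assumes M: "smooth_compact_domain M" and x: "x \<in> M"
  shows "iter_deriv M (\<lambda>x. x \<bullet> w) [b] x = b \<bullet> w"
    and "iter_deriv M (\<lambda>x. x \<bullet> w) [a, b] x = 0"
proof -
  have first: "iter_deriv M (\<lambda>x. x \<bullet> w) [b] x = b \<bullet> w" if "x \<in> M" for x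
  proof -
    have "((\<lambda>x. x \<bullet> w) has_derivative (\<lambda>h. h \<bullet> w)) (at x within M)"
      by (auto intro!: derivative_eq_intros)
    from frechet_derivative_within_domain[OF M that this] show ?thesis by simp
  qed
  then show "iter_deriv M (\<lambda>x. x \<bullet> w) [b] x = b \<bullet> w" using x .
  have "(iter_deriv M (\<lambda>x. x \<bullet> w) [b] has_derivative (\<lambda>h. 0)) (at x within M)"
    by (rule has_derivative_transform[OF x first has_derivative_const])
  from frechet_derivative_within_domain[OF M x this]
  show "iter_deriv M (\<lambda>x. x \<bullet> w) [a, b] x = 0" by simp
qed

lemma linear_harmonic:
  assumes M: "smooth_compact_domain M"
  shows "(\<lambda>x. x \<bullet> w) \<in> harmonic_functions M"
proof -
  have "iter_deriv UNIV (\<lambda>x. x \<bullet> w) vs differentiable (at x)" for vs x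
  proof -
    obtain u a where "iter_deriv UNIV (\<lambda>x. x \<bullet> w) vs = (\<lambda>x. x \<bullet> u + a)"
      using iter_deriv_linear_UNIV by blast
    then show ?thesis by simp
  qed
  then have "smooth_on_open UNIV (\<lambda>x. x \<bullet> w)"
    unfolding smooth_on_open_def by blast
  then have "smooth_on_domain M (\<lambda>x. x \<bullet> w)"
    unfolding smooth_on_domain_def by blast
  moreover have "laplacian M (\<lambda>x. x \<bullet> w) x = 0" if "x \<in> M" for x
    using iter_deriv_linear_domain(2)[OF M that] unfolding laplacian_def
    by (simp del: iter_deriv.simps)
  ultimately show ?thesis
    unfolding harmonic_functions_def by blast
qed

text \<open>The value is at most \<open>R\<bar>w\<bar>\<close> and the first derivatives are at most \<open>\<bar>w\<bar>\<close>; the factor \<open>1 + R\<close>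
  dominates both.\<close>

lemma linear_Ck_norm_le:
  fixes M :: "'a::euclidean_space set"
  assumes M: "smooth_compact_domain M" and R: "\<And>x. x \<in> M \<Longrightarrow> norm x \<le> R"
    and w: "(1 + R) * norm w \<le> 1" and R0: "0 \<le> R"
  shows "Ck_norm M 1 (\<lambda>x. x \<bullet> w) \<le> 1"
  unfolding Ck_norm_def sup_norm_on_def
proof (intro SUP_least)
  fix vs :: "'a list" and x assume "vs \<in> {vs \<in> lists Basis. length vs \<le> 1}" and x: "x \<in> M"
  then consider "vs = []" | b where "b \<in> Basis" "vs = [b]"
    by (cases vs) auto
  then have "\<bar>iter_deriv M (\<lambda>x. x \<bullet> w) vs x\<bar> \<le> (1 + R) * norm w"
  proof cases
    case 1
    have "\<bar>x \<bullet> w\<bar> \<le> norm x * norm w" by (rule Cauchy_Schwarz_ineq2)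
    also have "\<dots> \<le> (1 + R) * norm w"
      using R[OF x] by (intro mult_right_mono) auto
    finally show ?thesis using 1 by simp
  next
    case 2
    have "\<bar>b \<bullet> w\<bar> \<le> norm b * norm w" by (rule Cauchy_Schwarz_ineq2)
    also have "\<dots> \<le> (1 + R) * norm w"
      using 2 R0 by (intro mult_right_mono) auto
    finally show ?thesis
      using 2 iter_deriv_linear_domain(1)[OF M x] by (simp del: iter_deriv.simps)
  qed
  then show "ennreal \<bar>iter_deriv M (\<lambda>x. x \<bullet> w) vs x\<bar> \<le> 1"
    using w by simp
qed

lemma H_diff_norm_bounds:
  assumes \<phi>: "\<phi> \<in> harmonic_functions M" "Ck_norm M 1 \<phi> \<le> 1"
    and p: "y \<in> \<Gamma>" "s \<in> {0..<r}"
  shows "ennreal \<bar>H_op M c1 \<phi> (y, s) - H_op M c2 \<phi> (y, s)\<bar> \<le> H_diff_norm M \<Gamma> r c1 c2"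
    and "ennreal \<bar>vector_derivative (\<lambda>t. H_op M c1 \<phi> (y, t) - H_op M c2 \<phi> (y, t))
           (at s within {0..<r})\<bar> \<le> H_diff_norm M \<Gamma> r c1 c2"
proof -
  let ?f = "\<lambda>p. H_op M c1 \<phi> p - H_op M c2 \<phi> p"
  have "C1_norm_cylinder M \<Gamma> r ?f \<le> H_diff_norm M \<Gamma> r c1 c2"
    unfolding H_diff_norm_def using \<phi> by (intro SUP_upper) simp
  moreover have "(y, s) \<in> \<Gamma> \<times> {0..<r}" using p by simp
  note upper = SUP_upper[OF this]
  have "ennreal \<bar>?f (y, s)\<bar> \<le> C1_norm_cylinder M \<Gamma> r ?f"
       "ennreal \<bar>vector_derivative (\<lambda>t. ?f (y, t)) (at s within {0..<r})\<bar>
          \<le> C1_norm_cylinder M \<Gamma> r ?f"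
    unfolding C1_norm_cylinder_def
    by (rule order_trans[OF _ upper], simp only: prod.case, intro Sup_upper, blast)+
  ultimately show
    "ennreal \<bar>?f (y, s)\<bar> \<le> H_diff_norm M \<Gamma> r c1 c2"
    "ennreal \<bar>vector_derivative (\<lambda>t. ?f (y, t)) (at s within {0..<r})\<bar> \<le> H_diff_norm M \<Gamma> r c1 c2"
    by (blast intro: order_trans)+
qed

section \<open>The stability estimate\<close>

text \<open>Both bounds are the duality \<open>\<bar>u\<bar> = sup {u \<bullet> w | \<bar>w\<bar> \<le> 1}\<close>, with \<open>w\<close> scaled by \<open>1 / (1 + R)\<close> so
  that \<open>x \<mapsto> x \<bullet> w\<close> has \<open>C\<^sup>1\<close> norm at most \<open>1\<close>.\<close>

lemma normal_map_diff_bound: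
  fixes M \<Gamma> :: "(real^'n::finite) set"
  assumes M: "smooth_compact_domain M" and R: "\<And>x. x \<in> M \<Longrightarrow> norm x \<le> R" "0 \<le> R"
    and p: "y \<in> \<Gamma>" "s \<in> {0..<r}"
    and v1: "(normal_map M (isotropic_metric c1) y has_vector_derivative v1) (at s within {0..<r})"
    and v2: "(normal_map M (isotropic_metric c2) y has_vector_derivative v2) (at s within {0..<r})"
    and N: "H_diff_norm M \<Gamma> r c1 c2 = ennreal N" "0 \<le> N"
  shows "norm (normal_map M (isotropic_metric c1) y s - normal_map M (isotropic_metric c2) y s)
           \<le> (1 + R) * N"
    and "norm (v1 - v2) \<le> (1 + R) * N"
proof -
  let ?\<Phi>1 = "normal_map M (isotropic_metric c1) y" and ?\<Phi>2 = "normal_map M (isotropic_metric c2) y"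
  have dual: "norm u \<le> (1 + R) * N"
    if test: "\<And>w. (1 + R) * norm w \<le> 1 \<Longrightarrow> \<bar>u \<bullet> w\<bar> \<le> N" for u :: "real^'n"
  proof -
    let ?w = "(1 / (1 + R)) *\<^sub>R sgn u"
    have "norm (sgn u) \<le> 1" by (simp add: norm_sgn)
    then have "\<bar>u \<bullet> ?w\<bar> \<le> N" using R(2) by (intro test) simp
    moreover have "u \<bullet> ?w = norm u / (1 + R)"
      by (cases "u = 0") (simp_all add: sgn_div_norm dot_square_norm power2_eq_square)
    ultimately show ?thesis using R(2) by (simp add: field_simps)
  qed
  have test: "\<bar>(?\<Phi>1 s - ?\<Phi>2 s) \<bullet> w\<bar> \<le> N" "\<bar>(v1 - v2) \<bullet> w\<bar> \<le> N"
    if w: "(1 + R) * norm w \<le> 1" for w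
  proof -
    note bounds = H_diff_norm_bounds[OF linear_harmonic[OF M]
        linear_Ck_norm_le[OF M R(1) w R(2)] p, of c1 c2]
    show "\<bar>(?\<Phi>1 s - ?\<Phi>2 s) \<bullet> w\<bar> \<le> N"
      using bounds(1) N by (simp add: H_op_def inner_diff_left)
    have "((\<lambda>t. (?\<Phi>1 t - ?\<Phi>2 t) \<bullet> w) has_vector_derivative (v1 - v2) \<bullet> w) (at s within {0..<r})"
      by (rule bounded_linear.has_vector_derivative[OF bounded_linear_inner_left])
         (rule has_vector_derivative_diff[OF v1 v2])
    moreover have "at s within {0..<r} \<noteq> bot"
      using p(2) by (simp add: trivial_limit_within islimpt_Ico)
    ultimately have "vector_derivative (\<lambda>t. (?\<Phi>1 t - ?\<Phi>2 t) \<bullet> w) (at s within {0..<r})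
        = (v1 - v2) \<bullet> w"
      by (intro vector_derivative_within)
    then show "\<bar>(v1 - v2) \<bullet> w\<bar> \<le> N"
      using bounds(2) N by (simp add: H_op_def inner_diff_left)
  qed
  show "norm (?\<Phi>1 s - ?\<Phi>2 s) \<le> (1 + R) * N" "norm (v1 - v2) \<le> (1 + R) * N"
    using dual test by blast+
qed

text \<open>Compare \<open>c'\<close> and \<open>c\<close> through the two points with the same boundary normal coordinates: the
  wave speeds there are the lengths of the velocities of the two geodesics. Only \<open>c\<close> is evaluated at
  both points, so the constant does not involve the Lipschitz constant of \<open>c'\<close>.\<close>

lemma pointwise_stability:
  fixes M \<Gamma> :: "(real^'n::finite) set"
  assumes M: "smooth_compact_domain M" and R: "\<And>x. x \<in> M \<Longrightarrow> norm x \<le> R" "0 \<le> R"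
    and c: "c \<in> wave_speeds M" "c' \<in> wave_speeds M" and L: "L-lipschitz_on M c"
    and p: "y \<in> \<Gamma>" "s \<in> {0..<r}"
    and dom: "(y, s) \<in> normal_map_domain M (isotropic_metric c) \<Gamma>"
      "(y, s) \<in> normal_map_domain M (isotropic_metric c') \<Gamma>"
    and N: "H_diff_norm M \<Gamma> r c' c = ennreal N" "0 \<le> N"
    and x: "x = normal_map M (isotropic_metric c') y s"
  shows "\<bar>c' x - c x\<bar> \<le> (1 + L) * ((1 + R) * N)"
proof -
  have r: "s < r" using p(2) by simp
  define z where "z = normal_map M (isotropic_metric c) y s"
  obtain v where v: "z \<in> M" "norm v = c z"
      "(normal_map M (isotropic_metric c) y has_vector_derivative v) (at s within {0..<r})"
    using normal_map_trajectory[OF M c(1) dom(1) r] unfolding z_def by metis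
  obtain v' where v': "x \<in> M" "norm v' = c' x"
      "(normal_map M (isotropic_metric c') y has_vector_derivative v') (at s within {0..<r})"
    using normal_map_trajectory[OF M c(2) dom(2) r] unfolding x by metis
  have close: "norm (x - z) \<le> (1 + R) * N" "norm (v' - v) \<le> (1 + R) * N"
    using normal_map_diff_bound[OF M R p v'(3) v(3) N] unfolding x z_def by blast+
  have "\<bar>c' x - c z\<bar> \<le> (1 + R) * N"
    using norm_triangle_ineq3[of v' v] close(2) v(2) v'(2) by simp
  moreover have "\<bar>c x - c z\<bar> \<le> L * norm (x - z)"
    using lipschitz_onD[OF L v'(1) v(1)] by (simp add: dist_norm)
  moreover have "L * norm (x - z) \<le> L * ((1 + R) * N)"
    using close(1) lipschitz_on_nonneg[OF L] by (rule mult_left_mono)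
  ultimately show ?thesis by (simp add: distrib_right)
qed

theorem theorem5p2:
  fixes M \<Gamma> \<Omega> :: "(real^'n::finite) set" and c :: "real^'n \<Rightarrow> real" and r0 :: real
  assumes "smooth_compact_domain M"
    and "openin (top_of_set (frontier M)) \<Gamma>"
    and "\<Omega> \<subseteq> M"
    and "0 < r0"
    and "c \<in> wave_speeds M"
  shows "\<exists>\<epsilon>0>0. \<forall>\<epsilon>. 0 < \<epsilon> \<and> \<epsilon> \<le> \<epsilon>0 \<longrightarrow>
    (\<forall>\<G>. admissible_family M \<Gamma> \<Omega> r0 \<G> \<and> c \<in> \<G> \<and>
       (\<forall>c'\<in>\<G>. Ck_norm M 2 (\<lambda>x. c' x - c x) \<le> ennreal \<epsilon>) \<longrightarrow>
       (\<exists>C>0. \<forall>c'\<in>\<G>.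
          sup_norm_on \<Omega> (\<lambda>x. (c' x)\<^sup>2 - (c x)\<^sup>2) \<le> ennreal C * H_diff_norm M \<Gamma> r0 c' c))"
\<comment> \<open>The threshold \<open>1\<close> serves to bound \<open>c' + c\<close> by \<open>2 * B + 1\<close>.\<close>
proof (rule exI[of _ "1::real"], intro conjI allI impI)
  fix \<epsilon> :: real and \<G>
  assume \<epsilon>: "0 < \<epsilon> \<and> \<epsilon> \<le> 1"
    and fam: "admissible_family M \<Gamma> \<Omega> r0 \<G> \<and> c \<in> \<G> \<and>
       (\<forall>c'\<in>\<G>. Ck_norm M 2 (\<lambda>x. c' x - c x) \<le> ennreal \<epsilon>)"
  note M = assms(1) and c = assms(5)
  have compact: "compact M" using M unfolding smooth_compact_domain_def by blast
  obtain L where L: "L-lipschitz_on M c"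
    using wave_speed_lipschitz[OF compact c] unfolding lipschitz_fun_def by blast
  then have L0: "0 \<le> L" by (rule lipschitz_on_nonneg)
  obtain B where B: "\<And>x. x \<in> M \<Longrightarrow> \<bar>c x\<bar> \<le> B" "0 \<le> B"
    using lipschitz_fun_bounded[OF compact wave_speed_lipschitz[OF compact c]]
    by (metis abs_ge_zero order_trans real_norm_def abs_ge_self)
  obtain R where R: "\<And>x. x \<in> M \<Longrightarrow> norm x \<le> R" "0 \<le> R"
    using compact_imp_bounded[OF compact] by (metis bounded_pos less_imp_le)
  define C where "C = (2 * B + 1) * ((1 + L) * (1 + R))"
  have "C > 0" unfolding C_def using B(2) L0 R(2) by (intro mult_pos_pos) auto
  moreover have "sup_norm_on \<Omega> (\<lambda>x. (c' x)\<^sup>2 - (c x)\<^sup>2) \<le> ennreal C * H_diff_norm M \<Gamma> r0 c' c"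
    if c': "c' \<in> \<G>" for c'
  proof (cases "H_diff_norm M \<Gamma> r0 c' c" rule: ennreal_cases)
    case top
    then show ?thesis using \<open>C > 0\<close> by (simp add: ennreal_mult_top)
  next
    case (real N)
    have speed': "c' \<in> wave_speeds M" using fam c' unfolding admissible_family_def by blast
    have "\<bar>(c' x)\<^sup>2 - (c x)\<^sup>2\<bar> \<le> C * N" if x: "x \<in> \<Omega>" for x
    proof -
      have "x \<in> closure \<Omega>" using x closure_subset by blast
      then obtain y s where ys: "y \<in> \<Gamma>" "s \<in> {0..<r0}" "x = normal_map M (isotropic_metric c') y s"
        using fam c' unfolding admissible_family_def by fastforce
      have "(y, s) \<in> normal_map_domain M (isotropic_metric c) \<Gamma>"
           "(y, s) \<in> normal_map_domain M (isotropic_metric c') \<Gamma>"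
        using fam c' ys(1,2) unfolding admissible_family_def by blast+
      from pointwise_stability[OF M R c speed' L ys(1,2) this real(2,1) ys(3)]
      have diff: "\<bar>c' x - c x\<bar> \<le> (1 + L) * ((1 + R) * N)" .
      have xM: "x \<in> M" using x assms(3) by blast
      have "ennreal \<bar>c' x - c x\<bar> \<le> sup_norm_on M (iter_deriv M (\<lambda>x. c' x - c x) [])"
        unfolding sup_norm_on_def using xM by (auto intro: SUP_upper2)
      also have "\<dots> \<le> Ck_norm M 2 (\<lambda>x. c' x - c x)"
        unfolding Ck_norm_def by (rule SUP_upper) simp
      also have "\<dots> \<le> ennreal \<epsilon>" using fam c' by blast
      finally have "\<bar>c' x - c x\<bar> \<le> 1" using \<epsilon> by (simp add: ennreal_le_iff)
      then have sum: "\<bar>c' x + c x\<bar> \<le> 2 * B + 1" using B(1)[OF xM] by linarith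
      have "\<bar>(c' x)\<^sup>2 - (c x)\<^sup>2\<bar> = \<bar>c' x + c x\<bar> * \<bar>c' x - c x\<bar>"
        by (simp add: square_diff_square_factored power2_eq_square abs_mult)
      also have "\<dots> \<le> (2 * B + 1) * ((1 + L) * ((1 + R) * N))"
        using sum diff B(2) by (intro mult_mono) auto
      finally show ?thesis by (simp add: C_def mult.assoc)
    qed
    then have "sup_norm_on \<Omega> (\<lambda>x. (c' x)\<^sup>2 - (c x)\<^sup>2) \<le> ennreal (C * N)"
      unfolding sup_norm_on_def by (intro SUP_least ennreal_leI)
    then show ?thesis
      using real \<open>C > 0\<close> by (simp add: ennreal_mult)
  qed
  ultimately show "\<exists>C>0. \<forall>c'\<in>\<G>.
      sup_norm_on \<Omega> (\<lambda>x. (c' x)\<^sup>2 - (c x)\<^sup>2) \<le> ennreal C * H_diff_norm M \<Gamma> r0 c' c"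
    by blast
qed simp

end
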